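(* Let $K$ be a field that is cube-rootable, i.e. $K=\{k^3 : k\in K\}$. Then all 2-dimensional endo-commutative straight algebras of type I over $K$ are isomorphic to the algebra $S(1,0,0,0,0,0)$, whose multiplication with respect to a linear base $\{e,f\}$ is $e^2=f$, $ef=fe=0$, $f^2=e$.
   Context: An algebra over a field $K$ is a $K$-vector space with a $K$-bilinear multiplication, not assumed associative, commutative or unital; isomorphism means bijective $K$-linear multiplicative map. An algebra $A$ is endo-commutative if $x^2y^2=(xy)^2$ for all $x,y\in A$. A 2-dimensional algebra is curled if $x^2$ is a scalar multiple of $x$ for every element $x$; otherwise it is straight. For $(p,q,a,b,c,d)\in K^6$, $S(p,q,a,b,c,d)$ denotes the (straight) algebra over $K$ with linear base $\{e,f\}$ and multiplication $e^2=f$, $ef=ae+bf$, $fe=ce+df$, $f^2=pe+qf$. An endo-commutative straight algebra of type I over $K$ is an endo-commutative algebra of the form $S(p,q,a,b,c,d)$ for which exactly one of $p,a,c$ is nonzero. *)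

theory Defs
  imports "HOL-Analysis.Cartesian_Space"
begin

locale nonassoc_algebra = vector_space scl
  for scl :: "'k::field \<Rightarrow> 'v::ab_group_add \<Rightarrow> 'v" +
  fixes mult :: "'v \<Rightarrow> 'v \<Rightarrow> 'v"
  assumes linear_mult_left: "Vector_Spaces.linear scl scl (\<lambda>x. mult x y)"
    and linear_mult_right: "Vector_Spaces.linear scl scl (\<lambda>y. mult x y)"

definition algebra_isomorphic ::
  "('k::field \<Rightarrow> 'v::ab_group_add \<Rightarrow> 'v) \<Rightarrow> ('v \<Rightarrow> 'v \<Rightarrow> 'v) \<Rightarrow>
   ('k \<Rightarrow> 'w::ab_group_add \<Rightarrow> 'w) \<Rightarrow> ('w \<Rightarrow> 'w \<Rightarrow> 'w) \<Rightarrow> bool" where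
  "algebra_isomorphic scl mult scl' mult' \<longleftrightarrow>
     nonassoc_algebra scl mult \<and> nonassoc_algebra scl' mult' \<and>
     (\<exists>\<phi>. Vector_Spaces.linear scl scl' \<phi> \<and> bij \<phi> \<and>
          (\<forall>x y. \<phi> (mult x y) = mult' (\<phi> x) (\<phi> y)))"

definition endo_commutative :: "('v \<Rightarrow> 'v \<Rightarrow> 'v) \<Rightarrow> bool" where
  "endo_commutative mult \<longleftrightarrow>
     (\<forall>x y. mult (mult x x) (mult y y) = mult (mult x y) (mult x y))"

definition curled :: "('k \<Rightarrow> 'v \<Rightarrow> 'v) \<Rightarrow> ('v \<Rightarrow> 'v \<Rightarrow> 'v) \<Rightarrow> bool" where
  "curled scl mult \<longleftrightarrow> (\<forall>x. \<exists>k. mult x x = scl k x)"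

definition linear_base2 ::
  "('k::field \<Rightarrow> 'v::ab_group_add \<Rightarrow> 'v) \<Rightarrow> 'v \<Rightarrow> 'v \<Rightarrow> bool" where
  "linear_base2 scl e f \<longleftrightarrow>
     e \<noteq> f \<and> \<not> module.dependent scl {e, f} \<and> module.span scl {e, f} = UNIV"

text \<open>The algebra given by \<^term>\<open>scl\<close> and \<^term>\<open>mult\<close> is \<open>S(p,q,a,b,c,d)\<close>
  with respect to the linear base \<open>{e, f}\<close>.\<close>

definition is_S ::
  "('k::field \<Rightarrow> 'v::ab_group_add \<Rightarrow> 'v) \<Rightarrow> ('v \<Rightarrow> 'v \<Rightarrow> 'v) \<Rightarrow> 'v \<Rightarrow> 'v \<Rightarrow>
   'k \<Rightarrow> 'k \<Rightarrow> 'k \<Rightarrow> 'k \<Rightarrow> 'k \<Rightarrow> 'k \<Rightarrow> bool" where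
  "is_S scl mult e f p q a b c d \<longleftrightarrow>
     nonassoc_algebra scl mult \<and> linear_base2 scl e f \<and>
     mult e e = f \<and>
     mult e f = scl a e + scl b f \<and>
     mult f e = scl c e + scl d f \<and>
     mult f f = scl p e + scl q f"

definition endo_commutative_straight_type_I ::
  "('k::field \<Rightarrow> 'v::ab_group_add \<Rightarrow> 'v) \<Rightarrow> ('v \<Rightarrow> 'v \<Rightarrow> 'v) \<Rightarrow> bool" where
  "endo_commutative_straight_type_I scl mult \<longleftrightarrow>
     endo_commutative mult \<and>
     (\<exists>e f p q a b c d. is_S scl mult e f p q a b c d \<and>
        (p \<noteq> 0 \<and> a = 0 \<and> c = 0 \<or> p = 0 \<and> a \<noteq> 0 \<and> c = 0 \<or> p = 0 \<and> a = 0 \<and> c \<noteq> 0))"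

text \<open>A concrete model of \<open>S(p,q,a,b,c,d)\<close> on \<open>K\<^sup>2\<close>, with \<open>e = axis 1 1\<close> and
  \<open>f = axis 2 1\<close>; see \<open>is_S_S_mult\<close>.\<close>

definition S_mult ::
  "'k::field \<Rightarrow> 'k \<Rightarrow> 'k \<Rightarrow> 'k \<Rightarrow> 'k \<Rightarrow> 'k \<Rightarrow> 'k ^ 2 \<Rightarrow> 'k ^ 2 \<Rightarrow> 'k ^ 2" where
  "S_mult p q a b c d x y =
     (x$1 * y$1) *s axis 2 1 +
     (x$1 * y$2) *s (a *s axis 1 1 + b *s axis 2 1) +
     (x$2 * y$1) *s (c *s axis 1 1 + d *s axis 2 1) +
     (x$2 * y$2) *s (p *s axis 1 1 + q *s axis 2 1)"

lemma linear_base2_axis: "linear_base2 ((*s) :: 'k::field \<Rightarrow> 'k^2 \<Rightarrow> 'k^2) (axis 1 1) (axis 2 1)"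
proof -
  have "cart_basis = {axis 1 1, axis 2 1 :: 'k^2}"
    by (auto simp: cart_basis_def UNIV_2)
  moreover have "axis 1 1 \<noteq> (axis 2 1 :: 'k^2)"
    by (simp add: axis_eq_axis)
  ultimately show ?thesis
    unfolding linear_base2_def
    using vec.independent_Basis vec.span_Basis by metis
qed

lemma nonassoc_algebra_S_mult: "nonassoc_algebra (*s) (S_mult p q a b c d)"
  by unfold_locales
    (simp_all add: S_mult_def vec_eq_iff forall_2 axis_def algebra_simps)

lemma is_S_S_mult: "is_S (*s) (S_mult p q a b c d) (axis 1 1) (axis 2 1) p q a b c d"
  unfolding is_S_def
  by (intro conjI nonassoc_algebra_S_mult linear_base2_axis)
    (simp_all add: S_mult_def vec_eq_iff forall_2 axis_def)

lemma is_S_dim: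
  assumes "is_S scl mult e f p q a b c d"
  shows "vector_space.dim scl UNIV = 2"
proof -
  interpret nonassoc_algebra scl mult
    using assms by (simp add: is_S_def)
  show ?thesis
    using assms dim_eq_card[of "{e, f}" UNIV] by (simp add: is_S_def linear_base2_def)
qed

lemma is_S_straight:
  assumes "is_S scl mult e f p q a b c d"
  shows "\<not> curled scl mult"
proof
  interpret nonassoc_algebra scl mult
    using assms by (simp add: is_S_def)
  assume "curled scl mult"
  then obtain k where "f = scl k e"
    using assms by (metis curled_def is_S_def)
  then have "f \<in> span {e}"
    by (simp add: span_base span_scale)
  then show False
    using assms by (metis independent_insert insert_commute is_S_def linear_base2_def singletonD)
qed

lemma endo_commutative_straight_type_I_S_mult:
  "endo_commutative_straight_type_I (*s) (S_mult 1 0 0 0 0 (0::'k::field))"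
proof -
  have "endo_commutative (S_mult 1 0 0 0 0 (0::'k))"
    by (simp add: endo_commutative_def S_mult_def vec_eq_iff forall_2 axis_def)
  then show ?thesis
    unfolding endo_commutative_straight_type_I_def
    using is_S_S_mult[of 1 "0::'k" 0 0 0 0] zero_neq_one by metis
qed

end

theory Submission
  imports Defs
begin

text \<open>Evaluating \<open>x\<^sup>2 y\<^sup>2 = (x y)\<^sup>2\<close> at \<open>(e, f)\<close> and \<open>(f, e)\<close> and comparing coordinates forces
  \<open>q = b = d = 0\<close> when \<open>p\<close> is the nonzero parameter. When \<open>a\<close> is, the pair
  \<open>(e, f)\<close> gives \<open>b = 0\<close>, and then the \<open>e\<close>-coordinate at \<open>(e, e + f)\<close> reads
  \<open>a\<^sup>2 = 0\<close>; the case of \<open>c\<close> is the case of \<open>a\<close> for the opposite algebra. What is left is \<open>S(p,0,0,0,0,0)\<close>, and the rescaled base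
  \<open>{t e, t\<^sup>2 f}\<close> with \<open>t\<^sup>3 = 1 / p\<close> turns it into \<open>S(1,0,0,0,0,0)\<close>.\<close>

text \<open>Moving everything to one side gives a vanishing combination of the independent vectors
  \<open>e\<close> and \<open>f\<close>. Every later comparison of coordinates rests on
  this.\<close>

lemma (in vector_space) linear_base2_coords_eq:
  assumes "linear_base2 scale e f"
    and "scale x e + scale y f = scale x' e + scale y' f"
  shows "x = x' \<and> y = y'"
proof -
  have ne: "e \<noteq> f" and ind: "\<not> dependent {e, f}"
    using assms(1) by (auto simp: linear_base2_def)
  define u where "u v = (if v = e then x - x' else y - y')" for v
  have "(\<Sum>v\<in>{e, f}. scale (u v) v) = 0"
    using ne assms(2) by (simp add: u_def algebra_simps)
  then have "\<forall>v\<in>{e, f}. u v = 0"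
    using ind dependent_finite[of "{e, f}"] by blast
  then show ?thesis
    using ne by (simp add: u_def)
qed

context nonassoc_algebra
begin

lemma mult_add_left: "mult (x + y) z = mult x z + mult y z"
  and mult_scale_left: "mult (scl k x) z = scl k (mult x z)"
  and mult_add_right: "mult x (y + z) = mult x y + mult x z"
  and mult_scale_right: "mult x (scl k y) = scl k (mult x y)"
  using linear_mult_left[of z] linear_mult_right[of x]
  by (auto simp: Vector_Spaces.linear_iff)

lemmas mult_bilinear = mult_add_left mult_scale_left mult_add_right mult_scale_right

lemma opposite: "nonassoc_algebra scl (\<lambda>x y. mult y x)"
  by unfold_locales (simp_all add: mult_bilinear)

end

text \<open>Reversing the product exchanges \<open>ef\<close> with \<open>fe\<close> and keeps both
  squares, so the pairs \<open>(a, b)\<close> and \<open>(c, d)\<close> trade places.\<close>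

lemma is_S_opposite:
  "is_S scl mult e f p q a b c d \<Longrightarrow> is_S scl (\<lambda>x y. mult y x) e f p q c d a b"
  by (auto simp: is_S_def intro: nonassoc_algebra.opposite)

lemma endo_commutative_opposite:
  "endo_commutative mult \<Longrightarrow> endo_commutative (\<lambda>x y. mult y x)"
  by (simp add: endo_commutative_def)

lemma endo_commutative_S_pnz:
  assumes S: "is_S scl mult e f p q 0 b 0 d"
    and ec: "endo_commutative mult" and p: "p \<noteq> 0"
  shows "q = 0 \<and> b = 0 \<and> d = 0"
proof -
  interpret nonassoc_algebra scl mult
    using S by (simp add: is_S_def)
  have base: "linear_base2 scl e f"
    and m: "mult e e = f" "mult e f = scl b f" "mult f e = scl d f"
      "mult f f = scl p e + scl q f"
    using S by (auto simp: is_S_def)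
  have "mult (mult e e) (mult f f) = mult (mult e f) (mult e f)"
    using ec unfolding endo_commutative_def by blast
  then have "scl (q * p) e + scl (p * d + q * q) f = scl (b\<^sup>2 * p) e + scl (b\<^sup>2 * q) f"
    by (simp add: m mult_bilinear power2_eq_square algebra_simps)
  then have 1: "q * p = b\<^sup>2 * p" "p * d + q * q = b\<^sup>2 * q"
    using linear_base2_coords_eq[OF base] by blast+
  have "mult (mult f f) (mult e e) = mult (mult f e) (mult f e)"
    using ec unfolding endo_commutative_def by blast
  then have "scl (q * p) e + scl (p * b + q * q) f = scl (d\<^sup>2 * p) e + scl (d\<^sup>2 * q) f"
    by (simp add: m mult_bilinear power2_eq_square algebra_simps)
  then have 2: "q * p = d\<^sup>2 * p" "p * b + q * q = d\<^sup>2 * q"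
    using linear_base2_coords_eq[OF base] by blast+
  \<comment> \<open>Cancelling \<open>p\<close> gives \<open>q = b^2\<close> and
    \<open>q = d^2\<close>, which reduces the two remaining equations to \<open>p * d = 0\<close>
    and \<open>p * b = 0\<close>. Hence \<open>b = d = 0\<close>, and then
    \<open>q = 0\<close>.\<close>
  show ?thesis
    using 1 2 p by (auto simp: power2_eq_square)
qed

text \<open>Since \<open>p\<close> and \<open>c\<close> vanish, any product with left factor
  \<open>f = e^2\<close> is a multiple of \<open>f\<close>. So \<open>e^2 y^2\<close> never has an
  \<open>e\<close>-coordinate, and it suffices to find \<open>y\<close> for which
  \<open>(e y)^2\<close> has one.\<close>

lemma not_endo_commutative_S_anz:
  assumes S: "is_S scl mult e f 0 q a b 0 d" and a: "a \<noteq> 0"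
  shows "\<not> endo_commutative mult"
proof
  assume ec: "endo_commutative mult"
  interpret nonassoc_algebra scl mult
    using S by (simp add: is_S_def)
  have base: "linear_base2 scl e f"
    and m: "mult e e = f" "mult e f = scl a e + scl b f" "mult f e = scl d f"
      "mult f f = scl q f"
    using S by (auto simp: is_S_def)
  have "mult (mult e e) (mult f f) = mult (mult e f) (mult e f)"
    using ec unfolding endo_commutative_def by blast
  then have "scl 0 e + scl (q * q) f
      = scl (a * b * a) e + scl (a * a + a * b * b + a * b * d + b * b * q) f"
    by (simp add: m mult_bilinear algebra_simps)
  then have b: "b = 0"
    using linear_base2_coords_eq[OF base] a by fastforce
  \<comment> \<open>With \<open>b = 0\<close> the product of \<open>e\<close> and
    \<open>e + f\<close> is \<open>a e + f\<close>; in its square the cross term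
    \<open>a (e f)\<close> contributes \<open>a^2 e\<close>.\<close>
  have "mult (mult e e) (mult (e + f) (e + f)) = mult (mult e (e + f)) (mult e (e + f))"
    using ec unfolding endo_commutative_def by blast
  then have "scl 0 e + scl (q + a * d + d * q + q * q) f
      = scl (a * a) e + scl (q + a * d + a * a) f"
    by (simp add: m b mult_bilinear algebra_simps)
  then show False
    using linear_base2_coords_eq[OF base] a by fastforce
qed

lemma linear_base2_scale:
  assumes "vector_space scl" "linear_base2 scl e f" "s \<noteq> 0" "t \<noteq> 0"
  shows "linear_base2 scl (scl s e) (scl t f)"
proof -
  interpret vector_space scl by fact
  \<comment> \<open>Equality would force \<open>s = 0\<close>. Distinctness is also what splits the
    sum over the two-element set into two terms below.\<close>
  have ne: "scl s e \<noteq> scl t f"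
    using linear_base2_coords_eq[OF assms(2), of s 0 0 t] assms(3) by auto
  have ind: "\<not> dependent {scl s e, scl t f}"
  proof
    assume "dependent {scl s e, scl t f}"
    then obtain u where u: "u (scl s e) \<noteq> 0 \<or> u (scl t f) \<noteq> 0"
      and "(\<Sum>v\<in>{scl s e, scl t f}. scl (u v) v) = 0"
      using dependent_finite[of "{scl s e, scl t f}"] by auto
    then have "scl (u (scl s e) * s) e + scl (u (scl t f) * t) f = scl 0 e + scl 0 f"
      using ne by simp
    then show False
      using linear_base2_coords_eq[OF assms(2)] u assms(3,4) by fastforce
  qed
  have "e = scl (inverse s) (scl s e)" "f = scl (inverse t) (scl t f)"
    using assms(3,4) by simp_all
  then have "e \<in> span {scl s e, scl t f}" "f \<in> span {scl s e, scl t f}"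
    by (metis span_base span_scale insertI1 insertI2)+
  then have "span {e, f} \<subseteq> span {scl s e, scl t f}"
    by (intro span_minimal subspace_span) auto
  then have "span {scl s e, scl t f} = UNIV"
    using assms(2) by (auto simp: linear_base2_def)
  with ne ind show ?thesis
    by (simp add: linear_base2_def)
qed

text \<open>The factor of \<open>f\<close> is forced by \<open>(t e)^2 = t^2 f\<close>, the mixed
  products stay zero, and \<open>(t^2 f)^2 = t^4 p e\<close> must equal \<open>t e\<close>, which is
  the condition on \<open>t\<close>.\<close>

lemma is_S_rescale:
  assumes S: "is_S scl mult e f p 0 0 0 0 0" and t: "t ^ 3 * p = 1"
  shows "is_S scl mult (scl t e) (scl (t\<^sup>2) f) 1 0 0 0 0 0"
proof -
  interpret nonassoc_algebra scl mult
    using S by (simp add: is_S_def)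
  have "t \<noteq> 0"
    using t by auto
  then have "linear_base2 scl (scl t e) (scl (t\<^sup>2) f)"
    using S by (intro linear_base2_scale vector_space_axioms) (auto simp: is_S_def)
  moreover have "t\<^sup>2 * (t\<^sup>2 * p) = t"
    using arg_cong[OF t, of "(*) t"] by (simp add: power2_eq_square power3_eq_cube mult_ac)
  ultimately show ?thesis
    using S by (simp add: is_S_def mult_bilinear nonassoc_algebra_axioms power2_eq_square)
qed

text \<open>The structure constants determine a bilinear product, so the linear map matching the two
  bases is multiplicative.\<close>

lemma is_S_isomorphic:
  fixes scl :: "'k::field \<Rightarrow> 'v::ab_group_add \<Rightarrow> 'v"
    and scl' :: "'k \<Rightarrow> 'w::ab_group_add \<Rightarrow> 'w"
  assumes S: "is_S scl mult e f p q a b c d" and S': "is_S scl' mult' e' f' p q a b c d"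
  shows "algebra_isomorphic scl mult scl' mult'"
proof -
  interpret A: nonassoc_algebra scl mult using S by (simp add: is_S_def)
  interpret B: nonassoc_algebra scl' mult' using S' by (simp add: is_S_def)
  interpret AB: vector_space_pair scl scl' ..
  interpret BA: vector_space_pair scl' scl ..
  interpret AA: vector_space_pair scl scl ..
  interpret BB: vector_space_pair scl' scl' ..
  have e: "e \<noteq> f" "\<not> A.dependent {e, f}" and span: "A.span {e, f} = UNIV"
    and e': "e' \<noteq> f'" "\<not> B.dependent {e', f'}" and span': "B.span {e', f'} = UNIV"
    using S S' by (auto simp: is_S_def linear_base2_def)
  obtain \<phi> where \<phi>: "Vector_Spaces.linear scl scl' \<phi>" "\<phi> e = e'" "\<phi> f = f'"
    using AB.linear_independent_extend[OF e(2), of "\<lambda>v. if v = e then e' else f'"] e(1) by auto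
  obtain \<psi> where \<psi>: "Vector_Spaces.linear scl' scl \<psi>" "\<psi> e' = e" "\<psi> f' = f"
    using BA.linear_independent_extend[OF e'(2), of "\<lambda>v. if v = e' then e else f"] e'(1) by auto
  \<comment> \<open>Each composite fixes a base pointwise, and linear maps that agree on a spanning
    set coincide.\<close>
  have "(\<psi> \<circ> \<phi>) x = id x" for x
    using AA.linear_eq_on[OF Vector_Spaces.linear_compose[OF \<phi>(1) \<psi>(1)] A.linear_id,
        of x "{e, f}"] \<phi>(2,3) \<psi>(2,3) span by force
  moreover have "(\<phi> \<circ> \<psi>) x = id x" for x
    using BB.linear_eq_on[OF Vector_Spaces.linear_compose[OF \<psi>(1) \<phi>(1)] B.linear_id,
        of x "{e', f'}"] \<phi>(2,3) \<psi>(2,3) span' by force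
  ultimately have "bij \<phi>"
    by (intro o_bij[of \<psi>]) auto
  moreover have "\<phi> (mult x y) = mult' (\<phi> x) (\<phi> y)" for x y
  proof -
    have lin: "\<phi> (u + v) = \<phi> u + \<phi> v" "\<phi> (scl k u) = scl' k (\<phi> u)" for u v k
      using \<phi>(1) by (auto simp: Vector_Spaces.linear_iff)
    have left: "Vector_Spaces.linear scl scl' (\<lambda>u. \<phi> (mult u v))"
      "Vector_Spaces.linear scl scl' (\<lambda>u. mult' (\<phi> u) (\<phi> v))"
      and right: "Vector_Spaces.linear scl scl' (\<lambda>v. \<phi> (mult u v))"
      "Vector_Spaces.linear scl scl' (\<lambda>v. mult' (\<phi> u) (\<phi> v))" for u v
      by (unfold_locales, simp_all add: lin A.mult_bilinear B.mult_bilinear)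
    have basis: "\<phi> (mult u v) = mult' (\<phi> u) (\<phi> v)" if "u \<in> {e, f}" "v \<in> {e, f}" for u v
    proof -
      have "mult e e = f" "mult e f = scl a e + scl b f" "mult f e = scl c e + scl d f"
        "mult f f = scl p e + scl q f" "mult' e' e' = f'" "mult' e' f' = scl' a e' + scl' b f'"
        "mult' f' e' = scl' c e' + scl' d f'" "mult' f' f' = scl' p e' + scl' q f'"
        using S S' unfolding is_S_def by blast+
      then show ?thesis
        using that \<phi>(2,3) lin by fastforce
    qed
    \<comment> \<open>Multiplicativity spreads from the base one argument at a time: first the right
      factor becomes arbitrary, then the left one.\<close>
    have "\<phi> (mult u y) = mult' (\<phi> u) (\<phi> y)" if "u \<in> {e, f}" for u
      using AB.linear_eq_on[OF right[of u], of y "{e, f}"] basis that span by auto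
    then show ?thesis
      using AB.linear_eq_on[OF left[of y], of x "{e, f}"] span by auto
  qed
  ultimately show ?thesis
    using \<phi>(1) A.nonassoc_algebra_axioms B.nonassoc_algebra_axioms
    unfolding algebra_isomorphic_def by blast
qed

theorem corollary3:
  fixes scl :: "'k::field \<Rightarrow> 'v::ab_group_add \<Rightarrow> 'v"
    and mult :: "'v \<Rightarrow> 'v \<Rightarrow> 'v"
  assumes cube_rootable: "(UNIV :: 'k set) = {k ^ 3 | k. True}"
    and type_I: "endo_commutative_straight_type_I scl mult"
  shows "algebra_isomorphic scl mult ((*s) :: 'k \<Rightarrow> 'k ^ 2 \<Rightarrow> 'k ^ 2) (S_mult 1 0 0 0 0 0)"
proof -
  obtain e f p q a b c d where ec: "endo_commutative mult"
    and S: "is_S scl mult e f p q a b c d"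
    and "p \<noteq> 0 \<and> a = 0 \<and> c = 0 \<or> p = 0 \<and> a \<noteq> 0 \<and> c = 0 \<or> p = 0 \<and> a = 0 \<and> c \<noteq> 0"
    using type_I unfolding endo_commutative_straight_type_I_def by blast
  then consider "p \<noteq> 0" "a = 0" "c = 0" | "p = 0" "a \<noteq> 0" "c = 0" | "p = 0" "a = 0" "c \<noteq> 0"
    by blast
  then show ?thesis
  proof cases
    case 1
    then have "is_S scl mult e f p 0 0 0 0 0"
      using S ec endo_commutative_S_pnz by metis
    \<comment> \<open>Cube-rootability enters here, applied to \<open>1 / p\<close>.\<close>
    moreover obtain t where "inverse p = t ^ 3"
      using cube_rootable by blast
    then have "t ^ 3 * p = 1"
      using 1(1) by (metis left_inverse)
    ultimately show ?thesis
      using is_S_rescale is_S_isomorphic is_S_S_mult by metis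
  next
    case 2
    \<comment> \<open>This case is contradictory, and so is the next one after passing to the
      opposite product.\<close>
    then show ?thesis
      using S ec not_endo_commutative_S_anz by metis
  next
    case 3
    then show ?thesis
      using is_S_opposite[OF S] endo_commutative_opposite[OF ec] not_endo_commutative_S_anz
      by metis
  qed
qed

end
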